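(* Let $n\geq 4$ and $2\leq k\leq\lfloor n/2\rfloor$, and let $G_{n,k}^{C}$ be the flip graph of $k$-element subsets of $[n]$ (defined in the context). Then: (i) if $n$ is even, then $G_{n,k}^{C}$ has no rainbow cycle; (ii) if $n$ is odd and $k=2$, then $G_{n,2}^{C}$ has a rainbow Hamilton cycle; (iii) if $n$ is odd and $k=2$, then $G_{n,2}^{C}$ has two edge-disjoint rainbow Hamilton cycles; (iv) if $n$ is odd and $3\leq k<n/3$, then $G_{n,k}^{C}$ has a rainbow cycle.
   Context: $G_{n,k}^{C}$ is the undirected graph whose vertices are the $k$-element subsets of $[n]=\{1,\dots,n\}$, with an edge between $A$ and $B$ whenever $A\setminus B=\{x\}$ and $B\setminus A=\{y\}$ for some $x\neq y$; this edge is labeled with the pair $\{x,y\}=A\triangle B$. A rainbow cycle (1-rainbow cycle) is a cycle (no repeated vertices) along which each of the $\binom{n}{2}$ pairs $\{x,y\}\subseteq[n]$ appears exactly once as an edge label. A rainbow Hamilton cycle is a rainbow cycle visiting every vertex. *)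

theory Defs
  imports Complex_Main
begin

definition flip_verts :: "nat \<Rightarrow> nat \<Rightarrow> nat set set" where
  "flip_verts n k = {A. A \<subseteq> {1..n} \<and> card A = k}"

definition flip_edges :: "nat \<Rightarrow> nat \<Rightarrow> nat set set set" where
  "flip_edges n k = {{A, B} | A B. A \<in> flip_verts n k \<and> B \<in> flip_verts n k \<and>
     (\<exists>x y. x \<noteq> y \<and> A - B = {x} \<and> B - A = {y})}"

definition flip_label :: "nat set \<Rightarrow> nat set \<Rightarrow> nat set" where
  "flip_label A B = sym_diff A B"

text \<open>A cycle in a simple graph is given by the list of its vertices in cyclic order, without
  repeating the start vertex; the step with index \<open>i\<close> joins \<open>c ! i\<close> to its cyclic successor.\<close>

definition cyc_succ :: "'a list \<Rightarrow> nat \<Rightarrow> 'a" where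
  "cyc_succ c i = c ! (Suc i mod length c)"

definition cycle_edges :: "'a list \<Rightarrow> 'a set set" where
  "cycle_edges c = {{c ! i, cyc_succ c i} | i. i < length c}"

definition graph_cycle :: "'a set \<Rightarrow> 'a set set \<Rightarrow> 'a list \<Rightarrow> bool" where
  "graph_cycle V E c \<longleftrightarrow>
     length c \<ge> 3 \<and> distinct c \<and> set c \<subseteq> V \<and> cycle_edges c \<subseteq> E"

definition rainbow_cycle :: "nat \<Rightarrow> nat \<Rightarrow> nat set list \<Rightarrow> bool" where
  "rainbow_cycle n k c \<longleftrightarrow> graph_cycle (flip_verts n k) (flip_edges n k) c \<and>
     (\<forall>P. P \<subseteq> {1..n} \<and> card P = 2 \<longrightarrow>
        (\<exists>!i. i < length c \<and> flip_label (c ! i) (cyc_succ c i) = P))"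

definition rainbow_hamilton_cycle :: "nat \<Rightarrow> nat \<Rightarrow> nat set list \<Rightarrow> bool" where
  "rainbow_hamilton_cycle n k c \<longleftrightarrow> rainbow_cycle n k c \<and> set c = flip_verts n k"

end

theory Submission
  imports Defs
begin

text \<open>
  Non-existence: each element lies in \<open>n - 1\<close> labels, and each of these toggles its membership.
  Along a closed walk the membership is toggled an even number of times, so \<open>n\<close> is odd.

  Existence: let \<open>n = 2 l + 1\<close> and take the elements to be the residues modulo \<open>n\<close>. Keep the
  elements \<open>1, \<dots>, k - 1\<close> fixed and let one further element walk from \<open>0\<close> to \<open>k\<close> in \<open>l\<close> steps
  whose cyclic lengths are \<open>1, \<dots>, l\<close> in some order. The last set of this block is the first one
  rotated by \<open>1\<close>, so the \<open>n\<close> rotations of the block close up to a cycle that uses each of the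
  \<open>n l\<close> labels once. It remains to choose the walk so that no two sets within the block are
  rotations of each other. For \<open>k = 2\<close> the cycle has as many vertices as the whole graph, and the
  reflection \<open>y \<mapsto> - y\<close> of it has no edge in common with it.
\<close>

section \<open>Parity\<close>

lemma even_card_changes_iff:
  "even (card {i. i < m \<and> f i \<noteq> f (Suc i)}) \<longleftrightarrow> f 0 = f m" for f :: "nat \<Rightarrow> bool"
proof (induction m)
  case (Suc m)
  have "{i. i < Suc m \<and> f i \<noteq> f (Suc i)} =
      (if f m \<noteq> f (Suc m) then insert m {i. i < m \<and> f i \<noteq> f (Suc i)}
       else {i. i < m \<and> f i \<noteq> f (Suc i)})"
    by (auto simp: less_Suc_eq)
  then show ?case
    using Suc.IH by auto
qed simp

lemma even_card_cyclic_changes: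
  fixes p :: "'a \<Rightarrow> bool"
  shows "even (card {i. i < length c \<and> p (c ! i) \<noteq> p (cyc_succ c i)})"
proof -
  \<comment> \<open>Indices modulo \<open>length c\<close> unroll the cycle into a sequence with
    equal values at \<open>0\<close> and \<open>length c\<close>.\<close>
  have "{i. i < length c \<and> p (c ! i) \<noteq> p (cyc_succ c i)} =
      {i. i < length c \<and> p (c ! (i mod length c)) \<noteq> p (c ! (Suc i mod length c))}"
    by (auto simp: cyc_succ_def)
  then show ?thesis
    using even_card_changes_iff[of "length c" "\<lambda>i. p (c ! (i mod length c))"] by simp
qed

lemma card_pairs_containing:
  assumes "a \<in> {1..n}"
  shows "card {P. P \<subseteq> {1..n} \<and> card P = 2 \<and> a \<in> P} = n - 1"
proof -
  have "{P. P \<subseteq> {1..n} \<and> card P = 2 \<and> a \<in> P} = (\<lambda>b. {a, b}) ` ({1..n} - {a})"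
    using assms by (auto simp: card_2_iff)
  moreover have "inj_on (\<lambda>b. {a, b}) ({1..n} - {a})"
    by (auto simp: inj_on_def doubleton_eq_iff)
  ultimately show ?thesis
    using assms by (simp add: card_image)
qed

lemma flip_edge_label:
  assumes "{A, B} \<in> flip_edges n k"
  shows "flip_label A B \<subseteq> {1..n}" "card (flip_label A B) = 2"
proof -
  obtain A' B' x y where AB: "{A, B} = {A', B'}" "A' \<in> flip_verts n k" "B' \<in> flip_verts n k"
      "x \<noteq> y" "A' - B' = {x}" "B' - A' = {y}"
    using assms unfolding flip_edges_def mem_Collect_eq by (elim exE conjE) (rule that)
  \<comment> \<open>The edge only determines its ends up to order, but the label is symmetric in
    them.\<close>
  have "flip_label A B = flip_label A' B'"
    using AB(1) unfolding flip_label_def doubleton_eq_iff by (metis Un_commute)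
  then have "flip_label A B = {x, y}"
    using AB(5,6) by (simp add: flip_label_def insert_commute)
  moreover have "x \<in> {1..n}" "y \<in> {1..n}"
    using AB(2,3,5,6) unfolding flip_verts_def by blast+
  ultimately show "flip_label A B \<subseteq> {1..n}" "card (flip_label A B) = 2"
    using AB(4) by auto
qed

lemma rainbow_cycle_imp_odd:
  assumes c: "rainbow_cycle n k c" and n: "n \<ge> 1"
  shows "odd n"
proof -
  let ?lab = "\<lambda>i. flip_label (c ! i) (cyc_succ c i)"
  let ?I = "{i. i < length c \<and> 1 \<in> ?lab i}"
  let ?P = "{P. P \<subseteq> {1..n} \<and> card P = 2 \<and> 1 \<in> P}"
  have lab: "?lab i \<subseteq> {1..n} \<and> card (?lab i) = 2" if "i < length c" for i
  proof -
    have "{c ! i, cyc_succ c i} \<in> cycle_edges c"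
      using that by (auto simp: cycle_edges_def)
    then have "{c ! i, cyc_succ c i} \<in> flip_edges n k"
      using c by (auto simp: rainbow_cycle_def graph_cycle_def)
    then show ?thesis
      using flip_edge_label by blast
  qed
  have uniq: "\<exists>!i. i < length c \<and> ?lab i = P" if "P \<subseteq> {1..n}" "card P = 2" for P
    using c that by (auto simp: rainbow_cycle_def)
  \<comment> \<open>The steps whose label contains \<open>1\<close> correspond bijectively to the
    pairs containing \<open>1\<close>.\<close>
  have "inj_on ?lab ?I"
  proof (rule inj_onI)
    fix i j assume "i \<in> ?I" "j \<in> ?I" "?lab i = ?lab j"
    then show "i = j"
      using uniq[of "?lab i"] lab[of i] by auto
  qed
  moreover have "?lab ` ?I = ?P"
  proof (intro equalityI subsetI)
    fix P assume "P \<in> ?lab ` ?I"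
    then show "P \<in> ?P" using lab by auto
  next
    fix P assume P: "P \<in> ?P"
    then obtain i where "i < length c" "?lab i = P"
      using uniq[of P] by auto
    then show "P \<in> ?lab ` ?I"
      using P by auto
  qed
  ultimately have "card ?I = card ?P"
    using card_image by fastforce
  also have "\<dots> = n - 1"
    using n by (intro card_pairs_containing) auto
  finally have "card ?I = n - 1" .
  moreover have "?I = {i. i < length c \<and> (1 \<in> c ! i) \<noteq> (1 \<in> cyc_succ c i)}"
    by (auto simp: flip_label_def)
  ultimately have "even (n - 1)"
    using even_card_cyclic_changes[of c "\<lambda>A. 1 \<in> A"] by simp
  then show ?thesis
    using n by simp
qed

section \<open>Cycles from rotated blocks\<close>

text \<open>An identification of the residues modulo \<open>n\<close> with \<open>{1..n}\<close>. It
  is kept abstract so that the same construction also applies to the reflected coordinates.\<close>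

definition residue_coords :: "nat \<Rightarrow> (int \<Rightarrow> nat) \<Rightarrow> bool" where
  "residue_coords n \<phi> \<longleftrightarrow> (\<forall>y z. \<phi> y = \<phi> z \<longleftrightarrow> int n dvd y - z) \<and> (\<forall>y. \<phi> y \<in> {1..n})"

lemma residue_coords_mod:
  assumes "n > 0"
  shows "residue_coords n (\<lambda>y. Suc (nat (y mod int n)))"
  unfolding residue_coords_def
proof (intro conjI allI)
  fix y z :: int
  have "nat (y mod int n) = nat (z mod int n) \<longleftrightarrow> y mod int n = z mod int n"
    using assms by (simp add: eq_nat_nat_iff)
  then show "Suc (nat (y mod int n)) = Suc (nat (z mod int n)) \<longleftrightarrow> int n dvd y - z"
    by (simp add: mod_eq_dvd_iff)
  have "y mod int n < int n"
    using assms by simp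
  then show "Suc (nat (y mod int n)) \<in> {1..n}"
    using assms by (auto simp: nat_less_iff Suc_le_eq)
qed

lemma residue_coords_uminus:
  assumes "residue_coords n \<phi>"
  shows "residue_coords n (\<lambda>y. \<phi> (- y))"
proof -
  have "int n dvd - y - - z \<longleftrightarrow> int n dvd y - z" for y z
    using dvd_minus_iff[of "int n" "y - z"] by (simp add: algebra_simps)
  then show ?thesis
    using assms by (simp add: residue_coords_def)
qed

definition block_set :: "nat \<Rightarrow> (nat \<Rightarrow> int) \<Rightarrow> nat \<Rightarrow> int set" where
  "block_set k x i = insert (x i) {1..int k - 1}"

text \<open>The assumption \<open>set_inj\<close> says that no two sets of the block are rotations of each other and
  that none of them is invariant under a nontrivial rotation.\<close>

locale block =
  fixes n l k :: nat and x :: "nat \<Rightarrow> int"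
  assumes n: "n = 2 * l + 1" and l: "l \<ge> 2" and k: "2 \<le> k" "k \<le> l"
    and x_first: "int n dvd x 0" and x_last: "int n dvd x l - int k"
    and x_avoids: "\<And>i z. i \<le> l \<Longrightarrow> z \<in> {1..int k - 1} \<Longrightarrow> \<not> int n dvd x i - z"
    and step_nonzero: "\<And>i. i < l \<Longrightarrow> \<not> int n dvd x (Suc i) - x i"
    and step_inj: "\<And>i j. i < l \<Longrightarrow> j < l \<Longrightarrow>
      int n dvd (x (Suc i) - x i) - (x (Suc j) - x j) \<or>
      int n dvd (x (Suc i) - x i) + (x (Suc j) - x j) \<Longrightarrow> i = j"
    and set_inj: "\<And>i j b. i < l \<Longrightarrow> j < l \<Longrightarrow>
      (\<And>y. (\<exists>z\<in>block_set k x i. int n dvd y - (b + z)) \<longleftrightarrow>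
            (\<exists>z\<in>block_set k x j. int n dvd y - z)) \<Longrightarrow> i = j \<and> int n dvd b"
begin

definition vert :: "(int \<Rightarrow> nat) \<Rightarrow> nat \<Rightarrow> nat \<Rightarrow> nat set" where
  "vert \<phi> b i = (\<lambda>z. \<phi> (int b + z)) ` block_set k x i"

text \<open>A block contributes \<open>l\<close> sets, not \<open>l + 1\<close>, because its set at
  position \<open>l\<close> is the first set of the next block.\<close>

definition cyc :: "(int \<Rightarrow> nat) \<Rightarrow> nat set list" where
  "cyc \<phi> = map (\<lambda>t. vert \<phi> (t div l) (t mod l)) [0..<n * l]"

lemma not_dvd_double:
  assumes "\<not> int n dvd z"
  shows "\<not> int n dvd 2 * z"
proof -
  have "coprime (int n) 2"
    using n by simp
  then show ?thesis
    using assms coprime_dvd_mult_right_iff by blast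
qed

lemma length_cyc: "length (cyc \<phi>) = n * l"
  by (simp add: cyc_def)

lemma card_pairs: "card {P. P \<subseteq> {1..n} \<and> card P = 2} = n * l"
proof -
  have "n choose 2 = n * l"
    using n by (simp add: choose_two)
  then show ?thesis
    using n_subsets[of "{1..n}" 2] by simp
qed

lemma block_set_distinct_residues:
  assumes "i \<le> l" "y \<in> block_set k x i" "z \<in> block_set k x i" "int n dvd y - z"
  shows "y = z"
proof -
  have small: "y' = z'" if "y' \<in> {1..int k - 1}" "z' \<in> {1..int k - 1}" "int n dvd y' - z'" for y' z'
  proof (rule ccontr)
    assume "y' \<noteq> z'"
    then have "int n \<le> \<bar>y' - z'\<bar>"
      using dvd_imp_le_int[OF _ that(3)] by simp
    then show False using that k n by auto
  qed
  have "int n dvd z - y"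
    using assms(4) dvd_minus_iff[of "int n" "y - z"] by simp
  then show ?thesis
    using assms small x_avoids[OF assms(1)] unfolding block_set_def by blast
qed

lemma dvd_diff_bounded:
  assumes "int n dvd int b - int b'" "b < n" "b' < n"
  shows "b = b'"
proof (rule ccontr)
  assume "b \<noteq> b'"
  then have "int n \<le> \<bar>int b - int b'\<bar>"
    using dvd_imp_le_int[OF _ assms(1)] by simp
  then show False using assms by auto
qed

section \<open>The cycle for a fixed identification of residues with elements\<close>

context
  fixes \<phi> :: "int \<Rightarrow> nat"
  assumes \<phi>: "residue_coords n \<phi>"
begin

lemma \<phi>_eq_iff: "\<phi> y = \<phi> z \<longleftrightarrow> int n dvd y - z"
  and \<phi>_range: "\<phi> y \<in> {1..n}"
  using \<phi> by (auto simp: residue_coords_def)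

lemma mem_vert_iff: "\<phi> y \<in> vert \<phi> b i \<longleftrightarrow> (\<exists>z\<in>block_set k x i. int n dvd y - (int b + z))"
  by (auto simp: vert_def \<phi>_eq_iff)

lemma vert_n: "vert \<phi> n i = vert \<phi> 0 i"
  by (auto simp: vert_def \<phi>_eq_iff intro!: image_cong)

text \<open>At position \<open>l\<close> the block holds the residues \<open>1, ..., k\<close>, at
  position \<open>0\<close> it holds \<open>0, ..., k - 1\<close>; these differ by a rotation by
  \<open>1\<close>.\<close>

lemma vert_wrap: "vert \<phi> b l = vert \<phi> (Suc b) 0"
proof -
  have z1: "(\<lambda>z. \<phi> (int (Suc b) + z)) ` {1..int k - 1} = (\<lambda>z. \<phi> (int b + z)) ` {2..int k}"
  proof -
    have *: "{2..int k} = (\<lambda>z. z + 1) ` {1..int k - 1}"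
      by (simp add: image_add_atLeastAtMost')
    show ?thesis
      unfolding * image_image by (simp add: algebra_simps)
  qed
  have e1: "\<phi> (int (Suc b) + x 0) = \<phi> (int b + 1)"
    using x_first by (simp add: \<phi>_eq_iff)
  have e2: "\<phi> (int b + x l) = \<phi> (int b + int k)"
    using x_last by (simp add: \<phi>_eq_iff)
  have "vert \<phi> (Suc b) 0 = (\<lambda>z. \<phi> (int b + z)) ` insert 1 {2..int k}"
    unfolding vert_def block_set_def image_insert z1 e1 ..
  also have "insert 1 {2..int k} = insert (int k) {1..int k - 1}"
    using k by auto
  also have "(\<lambda>z. \<phi> (int b + z)) ` insert (int k) {1..int k - 1} = vert \<phi> b l"
    unfolding vert_def block_set_def image_insert e2 ..
  finally show ?thesis ..
qed

lemma cyc_nth: "t < n * l \<Longrightarrow> cyc \<phi> ! t = vert \<phi> (t div l) (t mod l)"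
  by (simp add: cyc_def)

text \<open>Allowing position \<open>l\<close> in the successor hides both the change of block and
  the return from rotation \<open>n\<close> to rotation \<open>0\<close>.\<close>

lemma cyc_succ_cyc:
  assumes t: "t < n * l"
  shows "cyc_succ (cyc \<phi>) t = vert \<phi> (t div l) (Suc (t mod l))"
proof -
  have m: "t mod l < l"
    using l by simp
  have succ: "cyc_succ (cyc \<phi>) t = cyc \<phi> ! (Suc t mod (n * l))"
    by (simp add: cyc_succ_def length_cyc)
  show ?thesis
  proof (cases "Suc (t mod l) = l")
    case False
    then have dm: "Suc t div l = t div l" "Suc t mod l = Suc (t mod l)"
      using m by (auto simp: div_Suc mod_Suc)
    have "Suc t \<noteq> n * l"
    proof
      assume "Suc t = n * l"
      then have "Suc t mod l = 0" by simp
      with dm show False by simp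
    qed
    then have "Suc t < n * l" using t by simp
    then show ?thesis
      using dm by (simp add: succ cyc_nth)
  next
    case True
    then have dm: "Suc t div l = Suc (t div l)" "Suc t mod l = 0"
      by (auto simp: div_Suc mod_Suc)
    have R: "vert \<phi> (t div l) (Suc (t mod l)) = vert \<phi> (Suc (t div l)) 0"
      using True vert_wrap by simp
    show ?thesis
    proof (cases "Suc t = n * l")
      case True
      then have "Suc t div l = n" using l by simp
      then have "Suc (t div l) = n" using dm by simp
      moreover have "0 < n * l" using n l by simp
      ultimately show ?thesis
        using True by (simp add: succ R cyc_nth vert_n)
    next
      case False
      then have "Suc t < n * l" using t by simp
      then show ?thesis
        using dm by (simp add: succ R cyc_nth)
    qed
  qed
qed

lemma vert_in_flip_verts:
  assumes "i \<le> l"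
  shows "vert \<phi> b i \<in> flip_verts n k"
proof -
  have "inj_on (\<lambda>z. \<phi> (int b + z)) (block_set k x i)"
    using block_set_distinct_residues[OF assms] by (auto simp: inj_on_def \<phi>_eq_iff)
  then have "card (vert \<phi> b i) = card (block_set k x i)"
    by (simp add: vert_def card_image)
  also have "\<dots> = Suc (card {1..int k - 1})"
    unfolding block_set_def using x_avoids[OF assms, of "x i"] by (intro card_insert_disjoint) auto
  also have "\<dots> = k"
    using k by simp
  finally show ?thesis
    using \<phi>_range by (auto simp: flip_verts_def vert_def)
qed

lemma vert_diff:
  assumes "i \<le> l" "j \<le> l" "\<not> int n dvd x i - x j"
  shows "vert \<phi> b i - vert \<phi> b j = {\<phi> (int b + x i)}"
proof -
  have "\<phi> (int b + x i) \<notin> vert \<phi> b j"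
    using assms x_avoids[of i] by (auto simp: mem_vert_iff block_set_def)
  then show ?thesis
    by (auto simp: vert_def block_set_def)
qed

lemma vert_step:
  assumes i: "i < l"
  shows "vert \<phi> b i - vert \<phi> b (Suc i) = {\<phi> (int b + x i)}"
    and "vert \<phi> b (Suc i) - vert \<phi> b i = {\<phi> (int b + x (Suc i))}"
    and "\<phi> (int b + x i) \<noteq> \<phi> (int b + x (Suc i))"
proof -
  have *: "\<not> int n dvd x (Suc i) - x i" "\<not> int n dvd x i - x (Suc i)"
    using step_nonzero[OF i] dvd_minus_iff[of "int n" "x (Suc i) - x i"] by auto
  show "vert \<phi> b i - vert \<phi> b (Suc i) = {\<phi> (int b + x i)}"
    and "vert \<phi> b (Suc i) - vert \<phi> b i = {\<phi> (int b + x (Suc i))}"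
    using * i by (intro vert_diff; simp)+
  show "\<phi> (int b + x i) \<noteq> \<phi> (int b + x (Suc i))"
    using * by (simp add: \<phi>_eq_iff)
qed

lemma label_step:
  "i < l \<Longrightarrow> flip_label (vert \<phi> b i) (vert \<phi> b (Suc i)) =
     {\<phi> (int b + x i), \<phi> (int b + x (Suc i))}"
  unfolding flip_label_def by (simp add: vert_step insert_commute)

lemma edge_step:
  assumes "i < l"
  shows "{vert \<phi> b i, vert \<phi> b (Suc i)} \<in> flip_edges n k"
proof -
  have "\<exists>y z. y \<noteq> z \<and> vert \<phi> b i - vert \<phi> b (Suc i) = {y} \<and> vert \<phi> b (Suc i) - vert \<phi> b i = {z}"
    using vert_step[OF assms, of b] by metis
  moreover have "vert \<phi> b i \<in> flip_verts n k" "vert \<phi> b (Suc i) \<in> flip_verts n k"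
    using assms by (auto intro: vert_in_flip_verts)
  ultimately show ?thesis
    unfolding flip_edges_def mem_Collect_eq
    by (intro exI[of _ "vert \<phi> b i"] exI[of _ "vert \<phi> b (Suc i)"] conjI refl)
qed

lemma vert_inj:
  assumes "i < l" "j < l" "b < n" "b' < n" "vert \<phi> b i = vert \<phi> b' j"
  shows "i = j \<and> b = b'"
proof -
  \<comment> \<open>Translating both sets by \<open>- b'\<close> brings the second one to rotation
    \<open>0\<close>, as \<open>set_inj\<close> expects.\<close>
  have "(\<exists>z\<in>block_set k x i. int n dvd y - ((int b - int b') + z)) \<longleftrightarrow>
      (\<exists>z\<in>block_set k x j. int n dvd y - z)" for y
    using mem_vert_iff[of "y + int b'" b i] mem_vert_iff[of "y + int b'" b' j] assms(5)
    by (simp add: algebra_simps)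
  from set_inj[OF assms(1,2) this] show ?thesis
    using dvd_diff_bounded assms(3,4) by blast
qed

text \<open>Labels are unordered, so steps matter only up to sign. If the ends match crosswise,
  \<open>step_inj\<close> gives \<open>i = j\<close>, and then a step is its own negative modulo the
  odd \<open>n\<close>.\<close>

lemma label_inj:
  assumes i: "i < l" and j: "j < l" and b: "b < n" "b' < n"
    and eq: "{\<phi> (int b + x i), \<phi> (int b + x (Suc i))} =
      {\<phi> (int b' + x j), \<phi> (int b' + x (Suc j))}"
  shows "i = j \<and> b = b'"
proof -
  consider (same) "int n dvd (int b + x i) - (int b' + x j)"
      "int n dvd (int b + x (Suc i)) - (int b' + x (Suc j))"
    | (crossed) "int n dvd (int b + x i) - (int b' + x (Suc j))"
      "int n dvd (int b + x (Suc i)) - (int b' + x j)"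
    using eq by (auto simp: doubleton_eq_iff \<phi>_eq_iff)
  then show ?thesis
  proof cases
    case same
    then have "int n dvd (x (Suc i) - x i) - (x (Suc j) - x j)"
      using dvd_diff[OF same(2,1)] by (simp add: algebra_simps)
    then have "i = j" using step_inj i j by blast
    then show ?thesis
      using same(1) dvd_diff_bounded b by simp
  next
    case crossed
    have d: "int n dvd (x (Suc i) - x i) + (x (Suc j) - x j)"
      using dvd_diff[OF crossed(2,1)] by (simp add: algebra_simps)
    then have "i = j" using step_inj i j by blast
    then have "int n dvd 2 * (x (Suc i) - x i)" using d by simp
    then show ?thesis
      using not_dvd_double step_nonzero i by blast
  qed
qed

lemma distinct_cyc: "distinct (cyc \<phi>)"
proof -
  have "inj_on (\<lambda>t. vert \<phi> (t div l) (t mod l)) {0..<n * l}"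
  proof (rule inj_onI)
    fix t t' assume t: "t \<in> {0..<n * l}" "t' \<in> {0..<n * l}"
      and "vert \<phi> (t div l) (t mod l) = vert \<phi> (t' div l) (t' mod l)"
    then have "t mod l = t' mod l \<and> t div l = t' div l"
      using l by (intro vert_inj) (auto simp: less_mult_imp_div_less)
    then show "t = t'" by (metis div_mult_mod_eq)
  qed
  then show ?thesis
    by (simp add: cyc_def distinct_map)
qed

lemma cycle_edges_cyc:
  "cycle_edges (cyc \<phi>) \<subseteq> {{vert \<phi> b i, vert \<phi> b (Suc i)} | b i. i < l}"
proof
  fix e assume "e \<in> cycle_edges (cyc \<phi>)"
  then obtain t where t: "t < n * l" "e = {cyc \<phi> ! t, cyc_succ (cyc \<phi>) t}"
    by (auto simp: cycle_edges_def length_cyc)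
  then have "e = {vert \<phi> (t div l) (t mod l), vert \<phi> (t div l) (Suc (t mod l))}"
    by (simp add: cyc_nth cyc_succ_cyc)
  moreover have "t mod l < l" using l by simp
  ultimately show "e \<in> {{vert \<phi> b i, vert \<phi> b (Suc i)} | b i. i < l}" by blast
qed

text \<open>The \<open>n * l\<close> labels are distinct and there are exactly \<open>n * l\<close>
  pairs, so counting gives surjectivity.\<close>

lemma rainbow_cyc: "rainbow_cycle n k (cyc \<phi>)"
  unfolding rainbow_cycle_def
proof (intro conjI allI impI)
  have "3 \<le> n * l"
    using n l mult_le_mono[of 5 n 2 l] by simp
  moreover have "set (cyc \<phi>) \<subseteq> flip_verts n k"
  proof
    fix A assume "A \<in> set (cyc \<phi>)"
    then obtain t where "A = vert \<phi> (t div l) (t mod l)" by (auto simp: cyc_def)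
    moreover have "t mod l \<le> l" using l by (simp add: less_imp_le)
    ultimately show "A \<in> flip_verts n k" using vert_in_flip_verts by simp
  qed
  moreover have "cycle_edges (cyc \<phi>) \<subseteq> flip_edges n k"
  proof
    fix e assume "e \<in> cycle_edges (cyc \<phi>)"
    then obtain b i where "i < l" "e = {vert \<phi> b i, vert \<phi> b (Suc i)}"
      using cycle_edges_cyc by blast
    then show "e \<in> flip_edges n k" using edge_step by simp
  qed
  ultimately show "graph_cycle (flip_verts n k) (flip_edges n k) (cyc \<phi>)"
    by (simp add: graph_cycle_def length_cyc distinct_cyc)
next
  fix P :: "nat set" assume P: "P \<subseteq> {1..n} \<and> card P = 2"
  let ?lab = "\<lambda>t. flip_label (cyc \<phi> ! t) (cyc_succ (cyc \<phi>) t)"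
  have lab: "?lab t = {\<phi> (int (t div l) + x (t mod l)), \<phi> (int (t div l) + x (Suc (t mod l)))}"
    if "t < n * l" for t
    using that l by (simp add: cyc_nth cyc_succ_cyc label_step)
  have inj: "inj_on ?lab {..<n * l}"
  proof (rule inj_onI)
    fix t t' assume t: "t \<in> {..<n * l}" "t' \<in> {..<n * l}" and eq: "?lab t = ?lab t'"
    have "t mod l = t' mod l \<and> t div l = t' div l"
    proof (rule label_inj)
      show "t mod l < l" "t' mod l < l" using l by auto
      show "t div l < n" "t' div l < n" using t by (auto simp: less_mult_imp_div_less)
    qed (use eq t in \<open>simp add: lab\<close>)
    then show "t = t'" by (metis div_mult_mod_eq)
  qed
  have "?lab ` {..<n * l} \<subseteq> {P. P \<subseteq> {1..n} \<and> card P = 2}"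
  proof
    fix Q assume "Q \<in> ?lab ` {..<n * l}"
    then obtain t where t: "t < n * l" "Q = ?lab t" by auto
    have "{vert \<phi> (t div l) (t mod l), vert \<phi> (t div l) (Suc (t mod l))} \<in> flip_edges n k"
      using l by (intro edge_step) simp
    from flip_edge_label[OF this] show "Q \<in> {P. P \<subseteq> {1..n} \<and> card P = 2}"
      using t by (simp add: cyc_nth cyc_succ_cyc)
  qed
  moreover have "card (?lab ` {..<n * l}) = n * l"
    using card_image[OF inj] by simp
  moreover have "finite {P. P \<subseteq> {1..n} \<and> card P = 2}"
    by (rule finite_subset[of _ "Pow {1..n}"]) auto
  ultimately have "?lab ` {..<n * l} = {P. P \<subseteq> {1..n} \<and> card P = 2}"
    using card_pairs by (intro card_subset_eq) auto
  then have "P \<in> ?lab ` {..<n * l}" using P by simp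
  then show "\<exists>!i. i < length (cyc \<phi>) \<and> ?lab i = P"
    using inj unfolding length_cyc inj_on_def by auto
qed

lemma rainbow_hamilton_cyc:
  assumes "k = 2"
  shows "rainbow_hamilton_cycle n 2 (cyc \<phi>)"
proof -
  have "set (cyc \<phi>) \<subseteq> flip_verts n 2"
    using rainbow_cyc assms by (simp add: rainbow_cycle_def graph_cycle_def)
  moreover have "card (set (cyc \<phi>)) = card (flip_verts n 2)"
    using distinct_card[OF distinct_cyc] card_pairs by (simp add: length_cyc flip_verts_def)
  moreover have "finite (flip_verts n 2)"
    unfolding flip_verts_def by (rule finite_subset[of _ "Pow {1..n}"]) auto
  ultimately have "set (cyc \<phi>) = flip_verts n 2"
    by (intro card_subset_eq)
  then show ?thesis
    using rainbow_cyc assms by (simp add: rainbow_hamilton_cycle_def)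
qed

end

text \<open>For \<open>k = 2\<close> an edge determines its label and the element common to its
  ends, which is the rotated \<open>1\<close>. Comparing both with their reflected counterparts
  forces \<open>i = j\<close> and makes \<open>n\<close> divide either \<open>2 * (x i - 1)\<close>
  or the sum in \<open>sum_nonzero\<close>.\<close>

lemma cycle_edges_uminus_disjoint:
  assumes \<phi>: "residue_coords n \<phi>" and k2: "k = 2"
    and sum_nonzero: "\<And>i. i < l \<Longrightarrow> \<not> int n dvd (x i - 1) + (x (Suc i) - 1)"
  shows "cycle_edges (cyc \<phi>) \<inter> cycle_edges (cyc (\<lambda>y. \<phi> (- y))) = {}"
proof (rule ccontr)
  let ?\<psi> = "\<lambda>y. \<phi> (- y)"
  note \<psi> = residue_coords_uminus[OF \<phi>]
  assume "\<not> ?thesis"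
  then obtain e where e: "e \<in> cycle_edges (cyc \<phi>)" "e \<in> cycle_edges (cyc ?\<psi>)"
    by auto
  obtain b i where i: "i < l" and ebi: "e = {vert \<phi> b i, vert \<phi> b (Suc i)}"
    using subsetD[OF cycle_edges_cyc[OF \<phi>] e(1)] by auto
  obtain b' j where j: "j < l" and ebj: "e = {vert ?\<psi> b' j, vert ?\<psi> b' (Suc j)}"
    using subsetD[OF cycle_edges_cyc[OF \<psi>] e(2)] by auto
  have eq: "{vert \<phi> b i, vert \<phi> b (Suc i)} = {vert ?\<psi> b' j, vert ?\<psi> b' (Suc j)}"
    using ebi ebj by simp
  have pivot: "vert \<phi>' c m \<inter> vert \<phi>' c (Suc m) = {\<phi>' (int c + 1)}"
    if \<phi>': "residue_coords n \<phi>'" and m: "m < l" for \<phi>' c m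
  proof -
    have "vert \<phi>' c r = {\<phi>' (int c + x r), \<phi>' (int c + 1)}" for r
      unfolding vert_def block_set_def using k2 by simp
    then show ?thesis
      using vert_step(3)[OF \<phi>' m, of c] by auto
  qed
  have "flip_label (vert \<phi> b i) (vert \<phi> b (Suc i)) = flip_label (vert ?\<psi> b' j) (vert ?\<psi> b' (Suc j))"
    using eq unfolding flip_label_def doubleton_eq_iff by (metis Un_commute)
  then have labs: "{\<phi> (int b + x i), \<phi> (int b + x (Suc i))} =
      {\<phi> (- (int b' + x j)), \<phi> (- (int b' + x (Suc j)))}"
    using label_step[OF \<phi> i] label_step[OF \<psi> j] by simp
  have "\<Inter> {vert \<phi> b i, vert \<phi> b (Suc i)} = \<Inter> {vert ?\<psi> b' j, vert ?\<psi> b' (Suc j)}"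
    using eq by simp
  then have "\<phi> (int b + 1) = \<phi> (- (int b' + 1))"
    using pivot[OF \<phi> i, of b] pivot[OF \<psi> j, of b'] by simp
  then have piv: "int n dvd (int b + 1) + (int b' + 1)"
    by (simp add: \<phi>_eq_iff[OF \<phi>] algebra_simps)
  consider (same) "int n dvd (int b + x i) + (int b' + x j)"
      "int n dvd (int b + x (Suc i)) + (int b' + x (Suc j))"
    | (crossed) "int n dvd (int b + x i) + (int b' + x (Suc j))"
      "int n dvd (int b + x (Suc i)) + (int b' + x j)"
    using labs by (auto simp: doubleton_eq_iff \<phi>_eq_iff[OF \<phi>] algebra_simps)
  then show False
  proof cases
    case same
    have "int n dvd (x (Suc i) - x i) + (x (Suc j) - x j)"
      using dvd_diff[OF same(2,1)] by (simp add: algebra_simps)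
    then have "i = j" using step_inj i j by blast
    then have "int n dvd 2 * (x i - 1)"
      using dvd_diff[OF same(1) piv] by (simp add: algebra_simps)
    moreover have "\<not> int n dvd x i - 1"
      using i k by (intro x_avoids) simp_all
    ultimately show False
      using not_dvd_double by blast
  next
    case crossed
    have "int n dvd (x (Suc i) - x i) - (x (Suc j) - x j)"
      using dvd_diff[OF crossed(2,1)] by (simp add: algebra_simps)
    then have "i = j" using step_inj i j by blast
    then have "int n dvd (x i - 1) + (x (Suc i) - 1)"
      using dvd_diff[OF crossed(1) piv] by (simp add: algebra_simps)
    then show False using sum_nonzero i by blast
  qed
qed

end

section \<open>Divisibility of integers of small absolute value\<close>

lemma not_dvd_small:
  fixes z :: int
  assumes "0 < \<bar>z\<bar>" "\<bar>z\<bar> < int n"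
  shows "\<not> int n dvd z"
  using assms dvd_imp_le_int[of z "int n"] by auto

text \<open>A multiple of \<open>n\<close> below \<open>2 * n\<close> in absolute value is
  \<open>0\<close> or \<open>n\<close> up to sign. Congruence of steps up to sign thus becomes a
  condition on their lengths.\<close>

lemma dvd_diff_or_sum_small:
  fixes u v :: int
  assumes "int n dvd u - v \<or> int n dvd u + v" "\<bar>u\<bar> < int n" "\<bar>v\<bar> < int n"
  shows "\<bar>u\<bar> = \<bar>v\<bar> \<or> \<bar>u\<bar> + \<bar>v\<bar> = int n"
proof -
  have *: "w = 0 \<or> \<bar>w\<bar> = int n" if "int n dvd w" "\<bar>w\<bar> < 2 * int n" for w
  proof -
    obtain q where q: "w = int n * q" using \<open>int n dvd w\<close> by (elim dvdE)
    have "\<bar>q\<bar> < 2"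
    proof (rule ccontr)
      assume "\<not> ?thesis"
      then have "int n * 2 \<le> int n * \<bar>q\<bar>" by (intro mult_left_mono) auto
      then show False using that(2) q by (simp add: abs_mult)
    qed
    then have "q = 0 \<or> q = 1 \<or> q = -1" by auto
    then show ?thesis using q by auto
  qed
  have "\<bar>u - v\<bar> < 2 * int n" "\<bar>u + v\<bar> < 2 * int n"
    using assms(2,3) by auto
  then have "u - v = 0 \<or> \<bar>u - v\<bar> = int n \<or> u + v = 0 \<or> \<bar>u + v\<bar> = int n"
    using assms(1) * by blast
  then show ?thesis
    using assms(2,3) by linarith
qed

section \<open>Walks for pairs\<close>

text \<open>Relative to the fixed element \<open>1\<close> the walk is \<open>-1, 2, -3, 4, \<dots>\<close>, with step lengths
  \<open>3, 5, \<dots>, 2 l - 1\<close>. Modulo sign and \<open>2 l + 1\<close> only the length \<open>1\<close> is missing, but closing up at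
  \<open>1\<close> would repeat a length. Keeping the sign once, just before index \<open>(l + 1) div 2\<close>, replaces
  exactly that repeated length by \<open>1\<close>.\<close>

definition pair_path :: "nat \<Rightarrow> nat \<Rightarrow> int" where
  "pair_path l i = (if i = l then 2 else
     1 + (if even i \<longleftrightarrow> i < (l + 1) div 2 then - (int i + 1) else int i + 1))"

text \<open>Relative to the fixed element, the final step leads to \<open>1\<close> from
  \<open>- l\<close> for even \<open>l\<close> and from \<open>l\<close> for odd \<open>l\<close>.
  The omitted length, \<open>l + 1\<close> or \<open>l + 2\<close> respectively, is the one
  congruent to it up to sign.\<close>

definition pair_step :: "nat \<Rightarrow> nat \<Rightarrow> nat" where
  "pair_step l i = (if Suc i = l then (if even l then l + 1 else l - 1)
     else if Suc i = (l + 1) div 2 then 1 else 2 * i + 3)"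

lemma pair_path_dist: "i < l \<Longrightarrow> \<bar>pair_path l i - 1\<bar> = int i + 1"
  by (auto simp: pair_path_def)

lemma pair_path_step:
  assumes "l \<ge> 2" "i < l"
  shows "\<bar>pair_path l (Suc i) - pair_path l i\<bar> = int (pair_step l i)"
proof (cases "Suc i = l")
  case True
  then have "\<not> i < (l + 1) div 2" using assms by auto
  then show ?thesis using True assms by (auto simp: pair_path_def pair_step_def)
next
  case False
  then have "i \<noteq> l" using assms by simp
  show ?thesis
  proof (cases "(l + 1) div 2 = Suc i")
    case True
    with False \<open>i \<noteq> l\<close> show ?thesis
      by (auto simp: pair_path_def pair_step_def)
  next
    case nd: False
    \<comment> \<open>Away from the switch the signs alternate, so the distances
      \<open>i + 1\<close> and \<open>i + 2\<close> add up.\<close>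
    then have "Suc i < (l + 1) div 2 \<longleftrightarrow> i < (l + 1) div 2" by auto
    with nd False \<open>i \<noteq> l\<close> show ?thesis
      by (auto simp: pair_path_def pair_step_def)
  qed
qed

lemma pair_step_bounds: "l \<ge> 2 \<Longrightarrow> i < l \<Longrightarrow> 0 < pair_step l i \<and> pair_step l i < 2 * l + 1"
  by (auto simp: pair_step_def)

text \<open>Parity decides. For even \<open>l\<close> all lengths are odd, so no two add up to the
  odd modulus. For odd \<open>l\<close> only the final length \<open>l - 1\<close> is even, and its
  complement \<open>l + 2\<close> is the omitted length.\<close>

lemma pair_step_inj:
  assumes "l \<ge> 2" "i < l" "j < l"
    and "pair_step l i = pair_step l j \<or> pair_step l i + pair_step l j = 2 * l + 1"
  shows "i = j"
proof (cases "even l")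
  case True
  then obtain m where m: "l = 2 * m" by (elim evenE)
  have step: "pair_step l r =
      (if Suc r = 2 * m then 2 * m + 1 else if Suc r = m then 1 else 2 * r + 3)" for r
    using m by (simp add: pair_step_def)
  have "odd (pair_step l r)" for r
    by (simp add: step)
  then have "even (pair_step l i + pair_step l j)"
    by simp
  then have "pair_step l i + pair_step l j \<noteq> 2 * l + 1"
    by (metis even_mult_iff even_plus_one_iff even_numeral)
  then have "pair_step l i = pair_step l j"
    using assms(4) by blast
  then show ?thesis
    using assms(2,3) m unfolding step by (auto simp only: split: if_splits; linarith)
next
  case False
  then obtain m where m: "l = 2 * m + 1" by (elim oddE)
  have step: "pair_step l r = (if r = 2 * m then 2 * m else if r = m then 1 else 2 * r + 3)" for r
    using m by (simp add: pair_step_def)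
  have ev: "even (pair_step l r) \<longleftrightarrow> r = 2 * m" for r
    unfolding step by simp
  show ?thesis
    using assms(4)
  proof
    assume eq: "pair_step l i = pair_step l j"
    then have "i = 2 * m \<longleftrightarrow> j = 2 * m"
      using ev by metis
    then show ?thesis
      using eq unfolding step by (auto simp only: split: if_splits; linarith)
  next
    assume sum: "pair_step l i + pair_step l j = 2 * l + 1"
    then have "(i = 2 * m) \<noteq> (j = 2 * m)"
      using ev by (metis even_add even_mult_iff even_plus_one_iff even_numeral)
    then show ?thesis
      using sum m unfolding step by (auto split: if_splits)
  qed
qed

text \<open>Needed for edge-disjointness. Alternating signs leave a sum of absolute value 1; at the
  switch and at the final step the sum is still nonzero and small.\<close>

lemma pair_path_sum:
  assumes "l \<ge> 2" "i < l"
  shows "\<not> int (2 * l + 1) dvd (pair_path l i - 1) + (pair_path l (Suc i) - 1)"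
proof -
  have "0 < \<bar>(pair_path l i - 1) + (pair_path l (Suc i) - 1)\<bar>"
    using assms by (auto simp: pair_path_def; presburger)
  moreover have "\<bar>(pair_path l i - 1) + (pair_path l (Suc i) - 1)\<bar> < int (2 * l + 1)"
    using assms by (auto simp: pair_path_def)
  ultimately show ?thesis by (rule not_dvd_small)
qed

lemma block_pair_path:
  assumes l: "l \<ge> 2"
  shows "block (2 * l + 1) l 2 (pair_path l)"
proof
  let ?n = "int (2 * l + 1)" and ?x = "pair_path l"
  have ne1: "\<not> ?n dvd ?x i - 1" if "i \<le> l" for i
  proof (rule not_dvd_small)
    show "0 < \<bar>?x i - 1\<bar>" "\<bar>?x i - 1\<bar> < ?n"
      using that l pair_path_dist[of i l] by (cases "i = l"; force simp: pair_path_def)+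
  qed
  show "int (2 * l + 1) dvd ?x 0" "int (2 * l + 1) dvd ?x l - int 2"
    using l by (auto simp: pair_path_def)
  show "\<not> ?n dvd ?x i - z" if "i \<le> l" "z \<in> {1..int 2 - 1}" for i z
    using ne1[OF that(1)] that(2) by simp
  show "\<not> ?n dvd ?x (Suc i) - ?x i" if "i < l" for i
    using pair_path_step[OF l that] pair_step_bounds[OF l that] by (intro not_dvd_small) auto
  show "i = j" if ij: "i < l" "j < l" and
    d: "?n dvd (?x (Suc i) - ?x i) - (?x (Suc j) - ?x j) \<or>
        ?n dvd (?x (Suc i) - ?x i) + (?x (Suc j) - ?x j)" for i j
  proof -
    have "int (pair_step l i) = int (pair_step l j) \<or>
        int (pair_step l i) + int (pair_step l j) = ?n"
      using dvd_diff_or_sum_small[OF d] pair_path_step[OF l ij(1)] pair_path_step[OF l ij(2)]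
        pair_step_bounds[OF l ij(1)] pair_step_bounds[OF l ij(2)] by simp
    then show ?thesis
      using pair_step_inj[OF l ij] by linarith
  qed
  show "i = j \<and> ?n dvd b"
    if ij: "i < l" "j < l" and
      eq: "\<And>y. (\<exists>z\<in>block_set 2 ?x i. ?n dvd y - (b + z)) \<longleftrightarrow> (\<exists>z\<in>block_set 2 ?x j. ?n dvd y - z)"
    for i j b
  proof -
    \<comment> \<open>The distances from \<open>1\<close> are \<open>1, ..., l\<close>, hence
      distinct even up to sign modulo \<open>2 * l + 1\<close>.\<close>
    have uv: "i = j" if "?n dvd (?x i - 1) - (?x j - 1) \<or> ?n dvd (?x i - 1) + (?x j - 1)"
      using dvd_diff_or_sum_small[OF that] pair_path_dist ij by auto
    have 1: "?n dvd b + ?x i - ?x j \<or> ?n dvd b + ?x i - 1"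
      using eq[of "b + ?x i"] by (auto simp: block_set_def)
    have 2: "?n dvd b + 1 - ?x j \<or> ?n dvd b"
      using eq[of "b + 1"] by (auto simp: block_set_def)
    show ?thesis
    proof (cases "?n dvd b")
      case True
      then have "\<not> ?n dvd b + ?x i - 1"
        using ne1[of i] ij dvd_add_right_iff[OF True, of "?x i - 1"] by (simp add: algebra_simps)
      then have "?n dvd (?x i - 1) - (?x j - 1)"
        using 1 dvd_add_right_iff[OF True, of "?x i - ?x j"] by (simp add: algebra_simps)
      then show ?thesis using uv True by blast
    next
      case False
      \<comment> \<open>A nontrivial rotation must exchange the fixed and the moving element. The
        differences to \<open>1\<close> are then opposite, which leads to \<open>i = j\<close> and a
        contradiction modulo an odd number.\<close>
      then have b: "?n dvd b + 1 - ?x j" using 2 by blast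
      have "\<not> ?n dvd b + ?x i - ?x j"
      proof
        assume "?n dvd b + ?x i - ?x j"
        from dvd_diff[OF this b] show False
          using ne1[of i] ij by (simp add: algebra_simps)
      qed
      then have c: "?n dvd b + ?x i - 1" using 1 by blast
      have s: "?n dvd (?x i - 1) + (?x j - 1)"
        using dvd_diff[OF c b] by (simp add: algebra_simps)
      then have "i = j" using uv by blast
      then have "?n dvd 2 * (?x i - 1)" using s by simp
      moreover have "coprime ?n 2" by simp
      ultimately have "?n dvd ?x i - 1" using coprime_dvd_mult_right_iff by blast
      then show ?thesis using ne1[of i] ij by simp
    qed
  qed
qed (use l in auto)

section \<open>Walks for larger sets\<close>

text \<open>Strictly between its ends the walk avoids the neighbours \<open>0\<close> and
  \<open>k\<close> of the fixed run \<open>1, ..., k - 1\<close>, which has length at least 2. The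
  run is therefore recognisable in each set, and its position determines the rotation.\<close>

lemma block_of_path:
  assumes n: "n = 2 * l + 1" and k: "3 \<le> k" "k \<le> l"
    and x0: "x 0 = int n" and xl: "x l = int k"
    and between: "\<And>i. 0 < i \<Longrightarrow> i < l \<Longrightarrow> int k < x i \<and> x i < int n"
    and inj: "\<And>i j. i < l \<Longrightarrow> j < l \<Longrightarrow> x i = x j \<Longrightarrow> i = j"
    and step: "\<And>i. i < l \<Longrightarrow> \<bar>x (Suc i) - x i\<bar> = int (s i) \<and> 0 < s i \<and> s i < n"
    and step_inj: "\<And>i j. i < l \<Longrightarrow> j < l \<Longrightarrow> s i = s j \<or> s i + s j = n \<Longrightarrow> i = j"
  shows "block n l k x"
proof
  have range: "int k \<le> x i \<and> x i \<le> int n" if "i \<le> l" for i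
    using that between[of i] x0 xl k n by (cases "i = 0 \<or> i = l") auto
  show "n = 2 * l + 1" "2 \<le> l" "2 \<le> k" "k \<le> l" using n k by auto
  show "int n dvd x 0" "int n dvd x l - int k" using x0 xl by auto
  show "\<not> int n dvd x i - z" if "i \<le> l" "z \<in> {1..int k - 1}" for i z
    using range[OF that(1)] that(2) by (intro not_dvd_small) auto
  show "\<not> int n dvd x (Suc i) - x i" if "i < l" for i
    using step[OF that] by (intro not_dvd_small) auto
  show "i = j" if ij: "i < l" "j < l" and
    d: "int n dvd (x (Suc i) - x i) - (x (Suc j) - x j) \<or>
        int n dvd (x (Suc i) - x i) + (x (Suc j) - x j)" for i j
  proof -
    have "int (s i) = int (s j) \<or> int (s i) + int (s j) = int n"
      using dvd_diff_or_sum_small[OF d] step[OF ij(1)] step[OF ij(2)] by simp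
    then show ?thesis
      using step_inj[OF ij] by linarith
  qed
  \<comment> \<open>In cyclic order, \<open>st i\<close> is the first element of the only run of length at least 2.\<close>
  define st where "st i = (if i = 0 then 0 else 1 :: int)" for i :: nat
  define P where "P i y \<longleftrightarrow> (\<exists>z\<in>block_set k x i. int n dvd y - z)" for i y
  \<comment> \<open>Representatives are taken in \<open>{1..n}\<close> rather than
    \<open>{0..n - 1}\<close>, matching \<open>x 0 = n\<close>.\<close>
  have P_range: "P i y \<longleftrightarrow> y < int k \<or> y = x i" if "i < l" "0 < y" "y \<le> int n" for i y
  proof
    assume "P i y"
    then obtain z where z: "z \<in> block_set k x i" "int n dvd y - z" by (auto simp: P_def)
    have "y = z"
    proof (rule ccontr)
      assume "y \<noteq> z"
      then have "\<not> int n dvd y - z"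
        using that z(1) range[of i] n k by (intro not_dvd_small) (auto simp: block_set_def)
      then show False using z(2) by blast
    qed
    then show "y < int k \<or> y = x i" using z(1) by (auto simp: block_set_def)
  next
    assume "y < int k \<or> y = x i"
    then show "P i y" using that unfolding P_def block_set_def by (intro bexI[of _ y]) auto
  qed
  have P_cong: "P i y \<longleftrightarrow> P i y'" if "int n dvd y - y'" for i y y'
  proof -
    have "int n dvd y - z \<longleftrightarrow> int n dvd y' - z" for z
      using dvd_add_right_iff[OF that, of "y' - z"] by simp
    then show ?thesis by (simp add: P_def)
  qed
  have st: "P i y \<and> P i (y + 1) \<and> \<not> P i (y - 1) \<longleftrightarrow> int n dvd y - st i" if i: "i < l" for i y
  proof -
    have n0: "P i 0 \<longleftrightarrow> P i (int n)" "P i (int n + 1) \<longleftrightarrow> P i 1"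
      by (auto intro!: P_cong)
    define r where "r = (if y mod int n = 0 then int n else y mod int n)"
    have r: "0 < r" "r \<le> int n"
      using n pos_mod_bound[of "int n" y] pos_mod_sign[of "int n" y] by (auto simp: r_def le_less)
    have "y - r = int n * (y div int n) \<or> y - r = int n * (y div int n - 1)"
      by (auto simp: r_def minus_mod_eq_mult_div algebra_simps)
    then have ry: "int n dvd y - r" by auto
    have P3: "P i y \<longleftrightarrow> P i r" "P i (y + 1) \<longleftrightarrow> P i (r + 1)" "P i (y - 1) \<longleftrightarrow> P i (r - 1)"
      using ry by (auto intro!: P_cong)
    have ys: "int n dvd y - st i \<longleftrightarrow> int n dvd r - st i"
      using dvd_add_right_iff[OF ry, of "r - st i"] by simp
    have rs: "int n dvd r - st i \<longleftrightarrow> (if i = 0 then r = int n else r = 1)"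
    proof (cases "i = 0")
      case True
      then show ?thesis
        using r not_dvd_small[of r n] by (cases "r = int n") (auto simp: st_def)
    next
      case False
      then show ?thesis
        using r not_dvd_small[of "r - 1" n] by (cases "r = 1") (auto simp: st_def)
    qed
    have Pr: "P i r \<longleftrightarrow> r < int k \<or> r = x i" using P_range[OF i r] .
    \<comment> \<open>The neighbours wrap around: \<open>n + 1\<close> becomes \<open>1\<close>,
      which is always present, and \<open>0\<close> becomes \<open>n\<close>, which is present only
      for \<open>i = 0\<close>.\<close>
    have Pr1: "P i (r + 1) \<longleftrightarrow> (if r = int n then True else r + 1 < int k \<or> r + 1 = x i)"
      using P_range[OF i, of "r + 1"] P_range[OF i, of 1] r n0 k n by auto
    have xi: "x i = int n \<longleftrightarrow> i = 0" "int k < x i" "x i \<le> int n"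
      using between[of i] i x0 k n by (cases "i = 0"; simp)+
    have "P i (r - 1) \<longleftrightarrow> P i (int n)" if "r = 1"
      using that n0 by simp
    then have Pr2: "P i (r - 1) \<longleftrightarrow> (if r = 1 then i = 0 else r - 1 < int k \<or> r - 1 = x i)"
      using P_range[OF i, of "r - 1"] P_range[OF i, of "int n"] r k n xi(1) by auto
    show ?thesis
      unfolding P3 ys rs Pr Pr1 Pr2
      using xi r k n by (cases "i = 0") auto
  qed
  show "i = j \<and> int n dvd b"
    if ij: "i < l" "j < l" and
      eq: "\<And>y. (\<exists>z\<in>block_set k x i. int n dvd y - (b + z)) \<longleftrightarrow>
               (\<exists>z\<in>block_set k x j. int n dvd y - z)"
    for i j b
  proof -
    have sh: "P i y \<longleftrightarrow> P j (y + b)" for y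
      using eq[of "y + b"] by (simp add: P_def algebra_simps)
    have "P i (st i) \<and> P i (st i + 1) \<and> \<not> P i (st i - 1)"
      using st[OF ij(1), of "st i"] by simp
    then have "P j (st i + b) \<and> P j (st i + b + 1) \<and> \<not> P j (st i + b - 1)"
      unfolding sh by (simp add: algebra_simps)
    then have d: "int n dvd st i + b - st j"
      using st[OF ij(2)] by blast
    have k1: "P m (int k) \<longleftrightarrow> False" if "m < l" for m
      using P_range[OF that, of "int k"] between[of m] that x0 k n by (cases "m = 0") auto
    \<comment> \<open>The run has \<open>k\<close> elements at index \<open>0\<close> and
      \<open>k - 1\<close> elsewhere. Aligning the starts of runs of different length puts the last
      element of the longer one on the absent residue \<open>k\<close>.\<close>
    have same: "(i = 0) = (j = 0)"
    proof (rule ccontr)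
      assume ne: "(i = 0) \<noteq> (j = 0)"
      show False
      proof (cases "i = 0")
        case True
        then have "int n dvd b - 1" using d ne by (simp add: st_def)
        then have "P j (int k - 1 + b) \<longleftrightarrow> P j (int k)"
          by (intro P_cong) simp
        moreover have "P i (int k - 1)" using P_range[OF ij(1)] k n by auto
        ultimately show False using sh k1[OF ij(2)] by blast
      next
        case False
        then have "int n dvd b + 1" using d ne by (simp add: st_def algebra_simps)
        then have "P j (int k + b) \<longleftrightarrow> P j (int k - 1)"
          by (intro P_cong) simp
        moreover have "P j (int k - 1)" using P_range[OF ij(2)] k n by auto
        ultimately show False using sh k1[OF ij(1)] by blast
      qed
    qed
    then have b: "int n dvd b" using d by (simp add: st_def split: if_splits)
    have "P i y \<longleftrightarrow> P j y" for y
      using sh[of y] P_cong[of "y + b" y j] b by simp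
    then have "P j (x i)"
      using P_range[OF ij(1), of "x i"] range[of i] ij k by simp
    then have "x i = x j"
      using P_range[OF ij(2), of "x i"] range[of i] ij k by simp
    then show ?thesis using inj ij b by blast
  qed
qed

text \<open>For \<open>k \<ge> 3\<close> the walk is \<open>t \<mapsto> n - zigzag t\<close>. Starting from \<open>0\<close>, the zigzag takes the
  alternating steps \<open>l + d, l - 1, \<dots>, l - 2 p + 1\<close>, spiralling inwards and leaving out the length
  \<open>l - 2 q\<close>; it then jumps upwards by \<open>l - 2 q\<close> and spirals outwards with the steps
  \<open>1, \<dots>, l - 2 p\<close>, ending at the top of an interval above the first spiral. The lengths \<open>l\<close> and
  \<open>l + 1\<close> agree modulo sign and \<open>2 l + 1\<close>, so \<open>d \<in> {0, 1}\<close> is free to adjust the parity of the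
  end point.\<close>

definition zigzag :: "nat \<Rightarrow> nat \<Rightarrow> nat \<Rightarrow> nat \<Rightarrow> nat \<Rightarrow> nat \<Rightarrow> int" where
  "zigzag l k p q d t =
    (if t = 0 then 0
     else if t < 2 * p then
       (if even t then int (t div 2) + int d
        else int l - int (t div 2) + int d - (if 2 * q < t then 1 else 0))
     else if even (l - t) then 2 * int l + 1 - int k - int ((l - t) div 2)
     else int l + 1 - int k + 2 * int p + int ((l - t) div 2))"

definition zigzag_step :: "nat \<Rightarrow> nat \<Rightarrow> nat \<Rightarrow> nat \<Rightarrow> nat \<Rightarrow> nat" where
  "zigzag_step l p q d t =
    (if t = 0 then l + d
     else if t < 2 * q then l - t
     else if t < 2 * p - 1 then l - t - 1
     else if t = 2 * p - 1 then l - 2 * q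
     else t + 1 - 2 * p)"

section \<open>Step lengths and values of the zigzag\<close>

context
  fixes l k p q d :: nat
  assumes pq: "1 \<le> q" "q < p" "2 * p \<le> l" "2 * q < (l + 1) div 2" and d: "d \<le> 1"
    and k: "2 * p + 2 * q + 1 = k + (l + 1) div 2 + d" "2 \<le> k" "k \<le> l"
begin

text \<open>This relation says that the jump from the end \<open>l - p + d\<close> of the first
  spiral has length \<open>l - 2 * q\<close>.\<close>

lemma zigzag_gap:
  "2 * int p + 2 * int q + 1 = int k + int ((l + 1) div 2) + int d"
  using k by linarith

lemma zigzag_step_eq:
  assumes t: "t < l"
  shows "\<bar>zigzag l k p q d (Suc t) - zigzag l k p q d t\<bar> = int (zigzag_step l p q d t)"
proof -
  consider "t = 0" | "0 < t" "t < 2 * p - 1" | "t = 2 * p - 1" | "2 * p \<le> t"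
    by linarith
  then show ?thesis
  proof cases
    case 1
    then show ?thesis using pq by (simp add: zigzag_def zigzag_step_def)
  next
    case 2
    show ?thesis
    proof (cases "even t")
      case True
      then obtain h where "t = 2 * h" by (elim evenE)
      then show ?thesis using 2 pq by (auto simp: zigzag_def zigzag_step_def)
    next
      case False
      then obtain h where "t = 2 * h + 1" by (elim oddE)
      then show ?thesis using 2 pq by (auto simp: zigzag_def zigzag_step_def; presburger)
    qed
  next
    \<comment> \<open>The parity of \<open>l\<close> decides whether the jump lands in the upper or
      the lower half of the second spiral.\<close>
    case 3
    then obtain h where h: "p = Suc h" using pq by (cases p) auto
    show ?thesis
    proof (cases "even l")
      case True
      then obtain m where "l = 2 * m" by (elim evenE)
      then show ?thesis using 3 pq h zigzag_gap by (auto simp: zigzag_def zigzag_step_def)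
    next
      case False
      then obtain m where "l = 2 * m + 1" by (elim oddE)
      then show ?thesis using 3 pq h zigzag_gap by (auto simp: zigzag_def zigzag_step_def)
    qed
  next
    case 4
    define r where "r = l - Suc t"
    have lt: "l = Suc t + r" using t by (simp add: r_def)
    show ?thesis
    proof (cases "even r")
      case True
      then obtain m where "r = 2 * m" by (elim evenE)
      then show ?thesis using 4 pq lt by (auto simp: zigzag_def zigzag_step_def)
    next
      case False
      then obtain m where "r = 2 * m + 1" by (elim oddE)
      then show ?thesis using 4 pq lt by (auto simp: zigzag_def zigzag_step_def)
    qed
  qed
qed

lemma zigzag_step_bounds: "t < l \<Longrightarrow> 0 < zigzag_step l p q d t \<and> zigzag_step l p q d t < 2 * l + 1"
  using pq d by (auto simp: zigzag_step_def)

text \<open>The first length is at most \<open>l + 1\<close> and all others are below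
  \<open>l\<close>, so two different steps never add up to \<open>2 * l + 1\<close>.\<close>

lemma zigzag_step_inj:
  assumes "t < l" "t' < l" "zigzag_step l p q d t = zigzag_step l p q d t' \<or>
    zigzag_step l p q d t + zigzag_step l p q d t' = 2 * l + 1"
  shows "t = t'"
proof -
  have q: "4 * q < l + 1" using pq(4) by linarith
  have b: "zigzag_step l p q d r < l" if "0 < r" "r < l" for r
    using that pq by (auto simp: zigzag_step_def)
  show ?thesis
    using assms(3)
  proof
    assume "zigzag_step l p q d t + zigzag_step l p q d t' = 2 * l + 1"
    then show ?thesis
      using b[of t] b[of t'] assms(1,2) d
      by (cases "t = 0"; cases "t' = 0") (auto simp: zigzag_step_def)
  next
    assume "zigzag_step l p q d t = zigzag_step l p q d t'"
    then show ?thesis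
      using assms(1,2) pq(1-3) q unfolding zigzag_step_def by (auto simp only: split: if_splits; linarith)
  qed
qed

text \<open>Six branches without \<open>div\<close> or parity tests, so that comparing values
  becomes linear arithmetic.\<close>

lemma zigzag_cases:
  assumes "t < l"
  obtains "t = 0" "zigzag l k p q d t = 0"
  | h where "t = 2 * h" "0 < h" "h < p" "zigzag l k p q d t = int h + int d"
  | h where "t = 2 * h + 1" "h < q" "zigzag l k p q d t = int l - int h + int d"
  | h where "t = 2 * h + 1" "q \<le> h" "h < p" "zigzag l k p q d t = int l - int h + int d - 1"
  | h where "l = t + 2 * h" "0 < h" "2 * p \<le> t" "zigzag l k p q d t = 2 * int l + 1 - int k - int h"
  | h where "l = t + 2 * h + 1" "2 * p \<le> t"
      "zigzag l k p q d t = int l + 1 - int k + 2 * int p + int h"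
proof -
  consider "t = 0" | "0 < t" "t < 2 * p" | "2 * p \<le> t" "0 < t"
    using pq by linarith
  then show thesis
  proof cases
    case 1
    then show thesis using that(1) by (simp add: zigzag_def)
  next
    case 2
    show thesis
    proof (cases "even t")
      case True
      then obtain h where "t = 2 * h" by (elim evenE)
      then show thesis using 2 that(2)[of h] by (simp add: zigzag_def)
    next
      case False
      then obtain h where h: "t = 2 * h + 1" by (elim oddE)
      show thesis
      proof (cases "h < q")
        case True
        then show thesis using 2 h that(3)[of h] by (simp add: zigzag_def)
      next
        case False
        then show thesis using 2 h that(4)[of h] by (simp add: zigzag_def)
      qed
    qed
  next
    case 3
    define r where "r = l - t"
    have lt: "l = t + r" "0 < r" using assms by (simp_all add: r_def)
    show thesis
    proof (cases "even r")
      case True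
      then obtain h where "r = 2 * h" by (elim evenE)
      then show thesis using 3 lt that(5)[of h] by (simp add: zigzag_def)
    next
      case False
      then obtain h where "r = 2 * h + 1" by (elim oddE)
      then show thesis using 3 lt that(6)[of h] by (simp add: zigzag_def)
    qed
  qed
qed

text \<open>The first spiral has maximum \<open>l + d\<close>, and the second lies at or above the
  right-hand side. By the gap relation the inequality amounts to
  \<open>2 * q < (l + 1) div 2\<close>.\<close>

lemma zigzag_separated: "int l + int d < int l + 1 - int k + 2 * int p"
  using zigzag_gap pq by linarith

lemma zigzag_between:
  assumes "0 < t" "t < l"
  shows "0 < zigzag l k p q d t \<and> zigzag l k p q d t < 2 * int l + 1 - int k"
  using assms(2) by (cases t rule: zigzag_cases) (use assms zigzag_separated pq(1-3) in linarith)+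

text \<open>The branches have disjoint ranges, and within each the value determines
  \<open>h\<close>.\<close>

lemma zigzag_inj:
  assumes "t < l" "t' < l" "zigzag l k p q d t = zigzag l k p q d t'"
  shows "t = t'"
  using assms(1)
  by (cases t rule: zigzag_cases;
      use assms(2) in \<open>cases t' rule: zigzag_cases\<close>;
      use assms zigzag_separated pq(1-3) in linarith)

end

lemma zigzag_parameters:
  assumes k: "3 \<le> k" "3 * k < 2 * l + 1"
  obtains p q d :: nat where "1 \<le> q" "q < p" "2 * p \<le> l" "2 * q < (l + 1) div 2" "d \<le> 1"
    "2 * p + 2 * q + 1 = k + (l + 1) div 2 + d"
proof -
  define c where "c = (l + 1) div 2"
  have c: "2 * c = l \<or> 2 * c = l + 1" unfolding c_def by linarith
  \<comment> \<open>The sum \<open>p + q\<close> has to be \<open>s\<close>, so \<open>d\<close> is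
    chosen to make \<open>k + c + d\<close> odd.\<close>
  define d where "d = (k + c + 1) mod 2"
  define s where "s = (k + c + d) div 2"
  have d1: "d \<le> 1" by (simp add: d_def)
  have "odd (k + c + d)"
    unfolding d_def by presburger
  then have s: "2 * s + 1 = k + c + d"
    unfolding s_def by simp
  show thesis
  proof (cases "2 * s \<le> l + 2")
    case True
    \<comment> \<open>The hypotheses force \<open>l \<ge> 5\<close>, which makes room for
      \<open>q = 1\<close> and \<open>p = s - 1\<close>.\<close>
    have "3 \<le> s" "2 < c" using s c k d1 by linarith+
    then show thesis
      using that[of 1 "s - 1" d] True s d1 unfolding c_def[symmetric] by simp
  next
    case False
    \<comment> \<open>Here \<open>p\<close> takes its largest value and \<open>q\<close> the rest of
      \<open>s\<close>; the bound on \<open>k\<close> keeps \<open>2 * q\<close> below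
      \<open>c\<close>.\<close>
    define p where "p = l div 2"
    have p: "2 * p = l \<or> 2 * p + 1 = l" unfolding p_def by linarith
    have "1 \<le> s - p" "s - p < p" "2 * (s - p) < c" "2 * p \<le> l"
      using False s c k d1 p by linarith+
    then show thesis
      using that[of "s - p" p d] s d1 unfolding c_def[symmetric] by simp
  qed
qed

lemma block_zigzag:
  assumes "3 \<le> k" "3 * k < 2 * l + 1"
  shows "\<exists>x. block (2 * l + 1) l k x"
proof -
  obtain p q d where pq: "1 \<le> q" "q < p" "2 * p \<le> l" "2 * q < (l + 1) div 2" "d \<le> 1"
    "2 * p + 2 * q + 1 = k + (l + 1) div 2 + d"
    using zigzag_parameters[OF assms] .
  have k: "2 \<le> k" "k \<le> l" using assms by auto
  note params = pq k
  let ?z = "zigzag l k p q d" and ?n = "2 * l + 1"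
  let ?x = "\<lambda>t. int ?n - ?z t"
  have "block ?n l k ?x"
  proof (rule block_of_path)
    show "?x 0 = int ?n" "?x l = int k"
      using pq by (simp_all add: zigzag_def)
    show "int k < ?x t \<and> ?x t < int ?n" if "0 < t" "t < l" for t
      using zigzag_between[OF params that] by simp
    show "t = t'" if "t < l" "t' < l" "?x t = ?x t'" for t t'
      using zigzag_inj[OF params that(1,2)] that(3) by simp
    show "\<bar>?x (Suc t) - ?x t\<bar> = int (zigzag_step l p q d t) \<and>
        0 < zigzag_step l p q d t \<and> zigzag_step l p q d t < ?n" if "t < l" for t
    proof -
      have "\<bar>?x (Suc t) - ?x t\<bar> = \<bar>?z (Suc t) - ?z t\<bar>" by simp
      then show ?thesis
        using zigzag_step_eq[OF params that] zigzag_step_bounds[OF params that] by simp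
    qed
    show "t = t'" if "t < l" "t' < l" "zigzag_step l p q d t = zigzag_step l p q d t' \<or>
        zigzag_step l p q d t + zigzag_step l p q d t' = ?n" for t t'
      using zigzag_step_inj[OF params that] .
  qed (use assms k in auto)
  then show ?thesis by blast
qed

theorem theorem15:
  fixes n k :: nat
  assumes "n \<ge> 4" and "2 \<le> k" and "k \<le> n div 2"
  shows "(even n \<longrightarrow> \<not> (\<exists>c. rainbow_cycle n k c)) \<and>
    (odd n \<and> k = 2 \<longrightarrow> (\<exists>c. rainbow_hamilton_cycle n 2 c)) \<and>
    (odd n \<and> k = 2 \<longrightarrow> (\<exists>c d. rainbow_hamilton_cycle n 2 c \<and> rainbow_hamilton_cycle n 2 d \<and>
        cycle_edges c \<inter> cycle_edges d = {})) \<and>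
    (odd n \<and> 3 \<le> k \<and> real k < real n / 3 \<longrightarrow> (\<exists>c. rainbow_cycle n k c))"
proof -
  have ham: "\<exists>c d. rainbow_hamilton_cycle n 2 c \<and> rainbow_hamilton_cycle n 2 d \<and>
      cycle_edges c \<inter> cycle_edges d = {}" if "odd n"
  proof -
    obtain l where n_eq: "n = 2 * l + 1" using \<open>odd n\<close> by (elim oddE)
    then have l2: "l \<ge> 2" using assms(1) by simp
    interpret block n l 2 "pair_path l"
      using block_pair_path[OF l2] n_eq by simp
    obtain \<phi> where \<phi>: "residue_coords n \<phi>"
      using residue_coords_mod[of n] n_eq by auto
    have "cycle_edges (cyc \<phi>) \<inter> cycle_edges (cyc (\<lambda>y. \<phi> (- y))) = {}"
      using pair_path_sum[OF l2] n_eq by (intro cycle_edges_uminus_disjoint[OF \<phi>]) auto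
    then show ?thesis
      using rainbow_hamilton_cyc[OF \<phi>] rainbow_hamilton_cyc[OF residue_coords_uminus[OF \<phi>]]
      by blast
  qed
  have "\<exists>c. rainbow_cycle n k c" if "odd n" "3 \<le> k" "real k < real n / 3"
  proof -
    obtain l where n_eq: "n = 2 * l + 1" using \<open>odd n\<close> by (elim oddE)
    have "3 * k < 2 * l + 1" using that(3) n_eq by simp
    then obtain x where "block n l k x"
      using block_zigzag[OF \<open>3 \<le> k\<close>] n_eq by blast
    then interpret block n l k x .
    show ?thesis
      using rainbow_cyc residue_coords_mod[of n] n_eq by auto
  qed
  moreover have "\<not> (\<exists>c. rainbow_cycle n k c)" if "even n"
    using rainbow_cycle_imp_odd[of n k] that assms(1) by auto
  ultimately show ?thesis
    using ham by blast
qed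

end
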